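(* Let $f_1\in\mathcal F_{\mu_1,L_1}$ and $f_2\in\mathcal F_{\mu_2,L_2}$ be functions on $\mathbb R^d$ satisfying the standing assumption (A) of the context, with $L_2\in[0,\mu_1]$, $\mu_2\in\big[\frac{-L_2\mu_1}{L_2+\mu_1},L_2\big)$ and $\mu_1+\mu_2>0$, and let $F=f_1-f_2$. Consider two DCA iterations connecting $x^k$, $x^{k+1}$ and $x^{k+2}$ (with $x^k\in\operatorname{dom}\partial f_1$). Then $$F(x^k)-F(x^{k+1})\;\ge\;\frac{\mu_1^2(L_2+\mu_1)}{L_2^2}\,\frac12\|x^{k+1}-x^{k+2}\|^2 .$$
   Context: Function class. For $\mu\in\mathbb R$ and $L\in(\mu,\infty]$, $\mathcal F_{\mu,L}$ denotes the set of proper, lower semicontinuous functions $f:\mathbb R^d\to\mathbb R\cup\{+\infty\}$ such that $f-\frac{\mu}{2}\|\cdot\|^2$ is convex and, if $L<\infty$, $f$ is finite-valued and $\frac L2\|\cdot\|^2-f$ is convex (no condition on the upper curvature if $L=\infty$). Subdifferential. For convex $f$, $\partial f(x)$ is the usual convex subdifferential. For $f\in\mathcal F_{\mu,L}$ with $\mu<0$, $\partial f(x):=\partial\tilde f(x)+\mu x$ where $\tilde f=f-\frac\mu2\|\cdot\|^2$ is convex. $\operatorname{dom}\partial f=\{x:\partial f(x)\ne\emptyset\}$ and $\operatorname{range}\partial f=\bigcup_x\partial f(x)$. Standing assumption (A). $f_1\in\mathcal F_{\mu_1,L_1}$ and $f_2\in\mathcal F_{\mu_2,L_2}$ with $0\le\mu_1<L_1\le\infty$,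 $\mu_2\in(-\infty,\infty)$, $L_2\in(\mu_2,\infty]$; $F=f_1-f_2$ (with the convention $(+\infty)-(+\infty)=+\infty$) is bounded below; $\emptyset\ne\operatorname{dom}\partial f_1\subseteq\operatorname{dom}\partial f_2$ and $\operatorname{range}\partial f_2\subseteq\operatorname{range}\partial f_1$. DCA (difference-of-convex algorithm). Given $x^k$, one iteration selects any $g_2^k\in\partial f_2(x^k)$ and any $x^{k+1}\in\arg\min_{w\in\mathbb R^d}\{f_1(w)-\langle g_2^k,w\rangle\}$. *)

theory Defs
  imports "HOL-Analysis.Analysis"
begin

definition proper_fun :: "('a \<Rightarrow> ereal) \<Rightarrow> bool" where
  "proper_fun f \<longleftrightarrow> (\<forall>x. f x \<noteq> -\<infinity>) \<and> (\<exists>x. f x \<noteq> \<infinity>)"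

definition lsc_fun :: "('a::topological_space \<Rightarrow> ereal) \<Rightarrow> bool" where
  "lsc_fun f \<longleftrightarrow> (\<forall>x. f x \<le> Liminf (at x) f)"

text \<open>
  Convexity of an extended-real-valued function, meant for functions that never take
  the value \<open>-\<infinity>\<close>; for \<open>u = 0\<close> the product \<open>0 * \<infinity>\<close> is \<open>0\<close> in \<open>ereal\<close>.
\<close>
definition econvex :: "('a::real_vector \<Rightarrow> ereal) \<Rightarrow> bool" where
  "econvex f \<longleftrightarrow> (\<forall>x y. \<forall>u\<ge>0. \<forall>v\<ge>0. u + v = 1 \<longrightarrow>
     f (u *\<^sub>R x + v *\<^sub>R y) \<le> ereal u * f x + ereal v * f y)"

definition sub_quad :: "real \<Rightarrow> ('a::real_normed_vector \<Rightarrow> ereal) \<Rightarrow> 'a \<Rightarrow> ereal" where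
  "sub_quad \<mu> f = (\<lambda>x. f x - ereal (\<mu> / 2 * (norm x)\<^sup>2))"

definition curv_class :: "real \<Rightarrow> ereal \<Rightarrow> ('a::euclidean_space \<Rightarrow> ereal) set" where
  "curv_class \<mu> L = {f. proper_fun f \<and> lsc_fun f \<and> econvex (sub_quad \<mu> f) \<and>
     (L < \<infinity> \<longrightarrow> (\<forall>x. f x \<noteq> \<infinity>) \<and>
        convex_on UNIV (\<lambda>x. real_of_ereal L / 2 * (norm x)\<^sup>2 - real_of_ereal (f x)))}"

text \<open>For proper \<open>f\<close> this set is empty at every \<open>x\<close> with \<open>f x = \<infinity>\<close>.\<close>
definition convex_subdiff :: "('a::euclidean_space \<Rightarrow> ereal) \<Rightarrow> 'a \<Rightarrow> 'a set" where
  "convex_subdiff f x = {g. \<forall>y. f x + ereal (g \<bullet> (y - x)) \<le> f y}"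

definition subdiff :: "real \<Rightarrow> ('a::euclidean_space \<Rightarrow> ereal) \<Rightarrow> 'a \<Rightarrow> 'a set" where
  "subdiff \<mu> f x =
     (if \<mu> < 0 then (\<lambda>g. g + \<mu> *\<^sub>R x) ` convex_subdiff (sub_quad \<mu> f) x
      else convex_subdiff f x)"

definition dom_subdiff :: "real \<Rightarrow> ('a::euclidean_space \<Rightarrow> ereal) \<Rightarrow> 'a set" where
  "dom_subdiff \<mu> f = {x. subdiff \<mu> f x \<noteq> {}}"

definition range_subdiff :: "real \<Rightarrow> ('a::euclidean_space \<Rightarrow> ereal) \<Rightarrow> 'a set" where
  "range_subdiff \<mu> f = (\<Union>x. subdiff \<mu> f x)"

text \<open>Subtraction on \<open>ereal\<close> satisfies \<open>\<infinity> - \<infinity> = \<infinity>\<close>, which is the convention intended here.\<close>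
definition dc_objective :: "('a \<Rightarrow> ereal) \<Rightarrow> ('a \<Rightarrow> ereal) \<Rightarrow> 'a \<Rightarrow> ereal" where
  "dc_objective f1 f2 x = f1 x - f2 x"

definition dc_assumption ::
  "real \<Rightarrow> ereal \<Rightarrow> real \<Rightarrow> ereal \<Rightarrow>
   ('a::euclidean_space \<Rightarrow> ereal) \<Rightarrow> ('a \<Rightarrow> ereal) \<Rightarrow> bool" where
  "dc_assumption \<mu>1 L1 \<mu>2 L2 f1 f2 \<longleftrightarrow>
     0 \<le> \<mu>1 \<and> ereal \<mu>1 < L1 \<and> ereal \<mu>2 < L2 \<and>
     f1 \<in> curv_class \<mu>1 L1 \<and> f2 \<in> curv_class \<mu>2 L2 \<and>
     (\<exists>c::real. \<forall>x. ereal c \<le> dc_objective f1 f2 x) \<and>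
     dom_subdiff \<mu>1 f1 \<noteq> {} \<and> dom_subdiff \<mu>1 f1 \<subseteq> dom_subdiff \<mu>2 f2 \<and>
     range_subdiff \<mu>2 f2 \<subseteq> range_subdiff \<mu>1 f1"

text \<open>
  \<open>x'\<close> is a possible outcome of one iteration started at \<open>x\<close>; the parameter \<open>\<mu>2\<close> is only
  used to form the subdifferential of \<open>f2\<close>.
\<close>
definition dca_step ::
  "real \<Rightarrow> ('a::euclidean_space \<Rightarrow> ereal) \<Rightarrow> ('a \<Rightarrow> ereal) \<Rightarrow> 'a \<Rightarrow> 'a \<Rightarrow> bool" where
  "dca_step \<mu>2 f1 f2 x x' \<longleftrightarrow>
     (\<exists>g \<in> subdiff \<mu>2 f2 x. is_arg_min (\<lambda>w. f1 w - ereal (g \<bullet> w)) (\<lambda>_. True) x')"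

end

theory Submission
  imports Defs
begin

text \<open>
  Optimality of the iterates gives \<open>g0 \<in> \<partial>f1(x1)\<close> and \<open>g1 \<in> \<partial>f1(x2)\<close>, where
  \<open>g0 \<in> \<partial>f2(x0)\<close> and \<open>g1 \<in> \<partial>f2(x1)\<close>. Strong convexity of \<open>f1\<close> and the interpolation inequality
  for \<open>f2\<close> bound the decrease of \<open>F\<close> below by a quadratic form \<open>q\<close> in \<open>d = x1 - x0\<close> and
  \<open>e = g1 - g0\<close>. The form \<open>q - (L2 + \<mu>1) / (2 * L2\<^sup>2) * \<parallel>e\<parallel>\<^sup>2\<close> vanishes at \<open>e = L2 * d\<close> and is a nonnegative
  combination of \<open>\<parallel>L2 * d - e\<parallel>\<^sup>2\<close> and the cocoercivity term \<open>\<langle>e - \<mu>2 * d, L2 * d - e\<rangle>\<close>; the lower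
  bound on \<open>\<mu>2\<close> is what makes the first coefficient nonnegative. Finally
  \<open>\<mu>1 * \<parallel>x1 - x2\<parallel> \<le> \<parallel>e\<parallel>\<close> by strong monotonicity of \<open>\<partial>f1\<close>.
\<close>

lemma norm_convex_combination_squared:
  fixes x y :: "'a::real_inner"
  shows "(norm ((1 - t) *\<^sub>R x + t *\<^sub>R y))\<^sup>2
    = (1 - t) * (norm x)\<^sup>2 + t * (norm y)\<^sup>2 - t * (1 - t) * (norm (y - x))\<^sup>2"
  by (simp add: power2_norm_eq_inner inner_simps inner_commute algebra_simps)

text \<open>Letting \<open>t\<close> tend to 0 from the right removes the remainder left by a
  first-order comparison once a factor \<open>t\<close> is cancelled.\<close>

lemma le_if_le_add_small:
  fixes a b c :: real
  assumes "\<And>t. 0 < t \<Longrightarrow> t < 1 \<Longrightarrow> a \<le> b + t * c"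
  shows "a \<le> b"
proof (rule tendsto_lowerbound)
  show "((\<lambda>t. b + t * c) \<longlongrightarrow> b) (at_right 0)"
    by (auto intro!: tendsto_eq_intros)
  show "eventually (\<lambda>t. a \<le> b + t * c) (at_right 0)"
    using assms by (auto simp: eventually_at_right_field intro!: exI[of _ 1])
qed simp

text \<open>At a point \<open>z\<close> of the segment from \<open>x\<close> to \<open>y\<close>,
  the subgradient bounds \<open>f z\<close> below and the curvature condition bounds it above.
  Dividing by \<open>t\<close> and letting \<open>t\<close> tend to 0 leaves the full quadratic
  term, for either sign of \<open>\<mu>\<close>.\<close>

lemma convex_subdiff_strong:
  fixes f :: "'a::euclidean_space \<Rightarrow> ereal"
  assumes conv: "econvex (sub_quad \<mu> f)" and proper: "proper_fun f"
    and g: "g \<in> convex_subdiff f x"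
  shows "f x + ereal (g \<bullet> (y - x) + \<mu> / 2 * (norm (y - x))\<^sup>2) \<le> f y"
proof (cases "f y")
  case (real b)
  have sub: "f x + ereal (g \<bullet> (z - x)) \<le> f z" for z
    using g by (simp add: convex_subdiff_def)
  obtain a where a: "f x = ereal a"
    using sub[of y] real proper by (cases "f x") (auto simp: proper_fun_def)
  have "a + g \<bullet> (y - x) + \<mu> / 2 * (norm (y - x))\<^sup>2 \<le> b"
  proof (rule le_if_le_add_small)
    fix t :: real assume t: "0 < t" "t < 1"
    define z where "z = (1 - t) *\<^sub>R x + t *\<^sub>R y"
    have "sub_quad \<mu> f z \<le> ereal (1 - t) * sub_quad \<mu> f x + ereal t * sub_quad \<mu> f y"
      using conv t unfolding econvex_def z_def by auto
    then have le: "f z - ereal (\<mu> / 2 * (norm z)\<^sup>2)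
        \<le> ereal ((1 - t) * (a - \<mu> / 2 * (norm x)\<^sup>2) + t * (b - \<mu> / 2 * (norm y)\<^sup>2))"
      by (simp add: sub_quad_def a real)
    moreover obtain c where c: "f z = ereal c"
      using le proper by (cases "f z") (auto simp: proper_fun_def)
    moreover have "\<mu> / 2 * (norm z)\<^sup>2 = (1 - t) * (\<mu> / 2 * (norm x)\<^sup>2)
        + t * (\<mu> / 2 * (norm y)\<^sup>2) - \<mu> / 2 * (t * (1 - t) * (norm (y - x))\<^sup>2)"
      unfolding z_def norm_convex_combination_squared by (simp add: field_simps)
    ultimately have "c \<le> (1 - t) * a + t * b - \<mu> / 2 * (t * (1 - t) * (norm (y - x))\<^sup>2)"
      by (simp add: algebra_simps)
    moreover have "a + t * (g \<bullet> (y - x)) \<le> c"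
    proof -
      have "z - x = t *\<^sub>R (y - x)"
        by (simp add: z_def algebra_simps)
      then show ?thesis using sub[of z] by (simp add: a c)
    qed
    ultimately have
      "t * (a + g \<bullet> (y - x) + \<mu> / 2 * (norm (y - x))\<^sup>2) \<le> t * (b + t * (\<mu> / 2 * (norm (y - x))\<^sup>2))"
      by (simp add: algebra_simps)
    then show "a + g \<bullet> (y - x) + \<mu> / 2 * (norm (y - x))\<^sup>2 \<le> b + t * (\<mu> / 2 * (norm (y - x))\<^sup>2)"
      using t by (simp only: mult_le_cancel_left_pos)
  qed
  then show ?thesis by (simp add: a real)
qed (use proper in \<open>auto simp: proper_fun_def\<close>)

text \<open>Merges the two branches of \<open>subdiff\<close>: for negative \<open>\<mu>\<close> the
  quadratic term is what remains when \<open>\<mu> / 2 * (norm y)\<^sup>2\<close> is expanded around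
  \<open>x\<close>.\<close>

lemma subdiff_lower_bound:
  fixes f :: "'a::euclidean_space \<Rightarrow> ereal"
  assumes conv: "econvex (sub_quad \<mu> f)" and proper: "proper_fun f"
    and g: "g \<in> subdiff \<mu> f x"
  shows "f x + ereal (g \<bullet> (y - x) + \<mu> / 2 * (norm (y - x))\<^sup>2) \<le> f y"
proof (cases "\<mu> < 0")
  case True
  then obtain h where h: "h \<in> convex_subdiff (sub_quad \<mu> f) x" "g = h + \<mu> *\<^sub>R x"
    using g by (auto simp: subdiff_def)
  then have "sub_quad \<mu> f x + ereal (h \<bullet> (y - x)) \<le> sub_quad \<mu> f y"
    by (simp add: convex_subdiff_def)
  moreover have "f x \<noteq> -\<infinity>" "f y \<noteq> -\<infinity>"
    using proper by (auto simp: proper_fun_def)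
  moreover have "g \<bullet> (y - x) + \<mu> / 2 * (norm (y - x))\<^sup>2
      = h \<bullet> (y - x) + \<mu> / 2 * (norm y)\<^sup>2 - \<mu> / 2 * (norm x)\<^sup>2"
    unfolding h(2) power2_norm_eq_inner
    by (simp add: inner_simps inner_commute algebra_simps)
  ultimately show ?thesis
    by (cases "f x"; cases "f y") (auto simp: sub_quad_def)
next
  case False
  then show ?thesis
    using g convex_subdiff_strong[OF conv proper] by (simp add: subdiff_def)
qed

text \<open>The lower bound on \<open>f\<close> makes \<open>L *\<^sub>R x - g\<close> a
  supergradient of the convex function \<open>\<phi>\<close> at \<open>x\<close>, up to a
  second-order term. Convexity turns this into a genuine subgradient inequality, which is the claim
  rearranged.\<close>

lemma curvature_upper_bound:
  fixes f :: "'a::real_inner \<Rightarrow> real"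
  assumes conv: "convex_on UNIV (\<lambda>x. L / 2 * (norm x)\<^sup>2 - f x)"
    and lower: "\<And>y. f x + g \<bullet> (y - x) + \<mu> / 2 * (norm (y - x))\<^sup>2 \<le> f y"
  shows "f y \<le> f x + g \<bullet> (y - x) + L / 2 * (norm (y - x))\<^sup>2"
proof -
  define d where "d = y - x"
  define \<phi> where "\<phi> = (\<lambda>x. L / 2 * (norm x)\<^sup>2 - f x)"
  have y: "y = x + d" by (simp add: d_def)
  have "\<phi> x + (L *\<^sub>R x - g) \<bullet> d \<le> \<phi> y"
  proof (rule le_if_le_add_small)
    fix t :: real assume t: "0 < t" "t < 1"
    define z where "z = x - t *\<^sub>R d"
    txt \<open>The point \<open>x\<close> lies between \<open>y\<close> and its reflection \<open>z\<close>, where the lower bound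
      on \<open>f\<close> is an upper bound on \<open>\<phi>\<close>.\<close>
    have x: "x = (t / (1 + t)) *\<^sub>R y + (1 / (1 + t)) *\<^sub>R z"
    proof -
      have "(1 + t) *\<^sub>R ((t / (1 + t)) *\<^sub>R y + (1 / (1 + t)) *\<^sub>R z) = t *\<^sub>R y + z"
        using t by (simp add: scaleR_add_right)
      also have "\<dots> = (1 + t) *\<^sub>R x" by (simp add: y z_def algebra_simps)
      finally show ?thesis using t by simp
    qed
    have "\<phi> ((t / (1 + t)) *\<^sub>R y + (1 / (1 + t)) *\<^sub>R z) \<le> t / (1 + t) * \<phi> y + 1 / (1 + t) * \<phi> z"
    proof -
      have "t / (1 + t) + 1 / (1 + t) = 1" using t by (simp add: field_simps)
      moreover have "0 \<le> t / (1 + t)" "0 \<le> 1 / (1 + t)" using t by auto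
      ultimately show ?thesis
        using conv[folded \<phi>_def] unfolding convex_on_def by blast
    qed
    then have "\<phi> x \<le> (t * \<phi> y + \<phi> z) / (1 + t)"
      unfolding x[symmetric] by (simp add: add_divide_distrib)
    then have "(1 + t) * \<phi> x \<le> t * \<phi> y + \<phi> z"
      using t by (simp add: field_simps)
    moreover have "\<phi> z \<le> \<phi> x - t * ((L *\<^sub>R x - g) \<bullet> d) + t * (t * ((L - \<mu>) / 2 * (norm d)\<^sup>2))"
      using lower[of z] unfolding \<phi>_def z_def power2_norm_eq_inner
      by (simp add: inner_simps inner_commute algebra_simps diff_divide_distrib power2_eq_square)
    ultimately have
      "t * (\<phi> x + (L *\<^sub>R x - g) \<bullet> d) \<le> t * (\<phi> y + t * ((L - \<mu>) / 2 * (norm d)\<^sup>2))"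
      by (simp add: algebra_simps)
    then show "\<phi> x + (L *\<^sub>R x - g) \<bullet> d \<le> \<phi> y + t * ((L - \<mu>) / 2 * (norm d)\<^sup>2)"
      using t by (simp only: mult_le_cancel_left_pos)
  qed
  then show ?thesis
    unfolding \<phi>_def y power2_norm_eq_inner by (simp add: inner_simps inner_commute algebra_simps)
qed

text \<open>\<open>f\<close> lies above a parabola anchored at \<open>x0\<close> and below one
  anchored at \<open>x1\<close>. Comparing the two parabolas at a single point eliminates
  \<open>f\<close> everywhere except at the anchors.\<close>

lemma interpolation_inequality:
  fixes f :: "'a::real_inner \<Rightarrow> real"
  assumes lower: "\<And>y. f x0 + g0 \<bullet> (y - x0) + \<mu> / 2 * (norm (y - x0))\<^sup>2 \<le> f y"
    and upper: "\<And>y. f y \<le> f x1 + g1 \<bullet> (y - x1) + L / 2 * (norm (y - x1))\<^sup>2"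
    and "\<mu> < L"
  shows "f x0 + g0 \<bullet> (x1 - x0) + \<mu> / 2 * (norm (x1 - x0))\<^sup>2
    + (norm (g1 - g0 - \<mu> *\<^sub>R (x1 - x0)))\<^sup>2 / (2 * (L - \<mu>)) \<le> f x1"
proof -
  define d where "d = x1 - x0"
  define v where "v = g1 - g0 - \<mu> *\<^sub>R d"
  define s where "s = 1 / (L - \<mu>)"
  have s: "s * (L - \<mu>) = 1" using \<open>\<mu> < L\<close> by (simp add: s_def)
  txt \<open>This point maximises the gap between the lower and the upper quadratic bound.\<close>
  define z where "z = x1 - s *\<^sub>R v"
  have g1: "g1 = g0 + v + \<mu> *\<^sub>R d" and x0: "x0 = x1 - d"
    by (simp_all add: v_def d_def)
  have "f x0 + g0 \<bullet> (z - x0) + \<mu> / 2 * (norm (z - x0))\<^sup>2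
      \<le> f x1 + g1 \<bullet> (z - x1) + L / 2 * (norm (z - x1))\<^sup>2"
    using lower[of z] upper[of z] by linarith
  \<comment> \<open>The product \<open>s * (L - \<mu>)\<close> is kept intact so that the fact
    \<open>s\<close> can rewrite it to 1.\<close>
  then have "f x0 + g0 \<bullet> d + \<mu> / 2 * (d \<bullet> d) + s * (v \<bullet> v)
      - s / 2 * (s * (L - \<mu>)) * (v \<bullet> v) \<le> f x1"
    unfolding z_def g1 power2_norm_eq_inner unfolding x0
    by (simp add: inner_simps inner_commute field_simps)
  moreover have "v \<bullet> v / (2 * (L - \<mu>)) = s * (v \<bullet> v) / 2"
    by (simp add: s_def)
  ultimately show ?thesis
    unfolding s d_def[symmetric] v_def[symmetric] power2_norm_eq_inner by linarith
qed

lemma descent_quadratic_bound: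
  fixes d e :: "'a::real_inner" and L m \<mu> :: real
  assumes "0 < L" "0 \<le> m" "\<mu> < L"
    and \<mu>: "- L * m / (L + m) \<le> \<mu>"
    and coco: "\<mu> * (norm d)\<^sup>2 + (norm (e - \<mu> *\<^sub>R d))\<^sup>2 / (L - \<mu>) \<le> e \<bullet> d"
  shows "(L + m) / L\<^sup>2 * (norm e)\<^sup>2
    \<le> (m + \<mu>) * (norm d)\<^sup>2 + (norm (e - \<mu> *\<^sub>R d))\<^sup>2 / (L - \<mu>)"
proof -
  define a b c where "a = d \<bullet> d" and "b = e \<bullet> d" and "c = e \<bullet> e"
  define D where "D = L - \<mu>"
  have D: "0 < D" using assms by (simp add: D_def)
  have n: "(norm (e - \<mu> *\<^sub>R d))\<^sup>2 = c - 2 * \<mu> * b + \<mu>\<^sup>2 * a"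
    unfolding power2_norm_eq_inner a_def b_def c_def
    by (simp add: inner_simps inner_commute algebra_simps power2_eq_square)
  have "0 \<le> (norm (e - L *\<^sub>R d))\<^sup>2" by simp
  also have "\<dots> = c - 2 * L * b + L\<^sup>2 * a"
    unfolding power2_norm_eq_inner a_def b_def c_def
    by (simp add: inner_simps inner_commute algebra_simps power2_eq_square)
  finally have N: "0 \<le> c - 2 * L * b + L\<^sup>2 * a" .
  have "\<mu> * a + (c - 2 * \<mu> * b + \<mu>\<^sup>2 * a) / D \<le> b"
    using coco unfolding n D_def by (simp add: a_def b_def power2_norm_eq_inner)
  \<comment> \<open>The right-hand side is the expansion of
    \<open>(e - \<mu> *\<^sub>R d) \<bullet> (L *\<^sub>R d - e)\<close>.\<close>
  then have M: "0 \<le> (b - \<mu> * a) * L - c + \<mu> * b"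
    using D by (simp add: field_simps D_def power2_eq_square)
  have "0 \<le> (L + m) * \<mu> + L * m"
    using \<mu> assms(1,2) by (simp add: field_simps)
  then have "0 \<le> ((L + m) * \<mu> + L * m) * (c - 2 * L * b + L\<^sup>2 * a)"
    using N by (rule mult_nonneg_nonneg)
  \<comment> \<open>Both weights come from matching the coefficients of \<open>a\<close>,
    \<open>b\<close> and \<open>c\<close> in the claim multiplied by
    \<open>L\<^sup>2 * D\<close>.\<close>
  moreover have "0 \<le> 2 * m * L * ((b - \<mu> * a) * L - c + \<mu> * b)"
    using M assms(1,2) by (intro mult_nonneg_nonneg[OF _ M]) simp
  ultimately have "0 \<le> 2 * m * L * ((b - \<mu> * a) * L - c + \<mu> * b)
      + ((L + m) * \<mu> + L * m) * (c - 2 * L * b + L\<^sup>2 * a)"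
    by simp
  also have "\<dots> = L\<^sup>2 * ((m + \<mu>) * a * D + (c - 2 * \<mu> * b + \<mu>\<^sup>2 * a)) - (L + m) * c * D"
    by (simp add: D_def algebra_simps power2_eq_square)
  finally have "(L + m) / L\<^sup>2 * c \<le> (m + \<mu>) * a + (c - 2 * \<mu> * b + \<mu>\<^sup>2 * a) / D"
    using D assms(1) by (simp add: field_simps)
  then show ?thesis
    unfolding n D_def by (simp add: a_def c_def power2_norm_eq_inner)
qed

lemma strong_monotone_norm_le:
  fixes x y g h :: "'a::real_inner"
  assumes "m * (norm (y - x))\<^sup>2 \<le> (h - g) \<bullet> (y - x)"
  shows "m * norm (y - x) \<le> norm (h - g)"
proof (cases "y = x")
  case False
  have "m * (norm (y - x))\<^sup>2 \<le> norm (h - g) * norm (y - x)"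
    using assms norm_cauchy_schwarz order_trans by blast
  then show ?thesis using False by (simp add: power2_eq_square)
qed simp

text \<open>Comparison with a point where \<open>f\<close> is finite rules out \<infinity> at the
  minimiser; the linear terms can then be moved across, which is Fermat's rule.\<close>

lemma arg_min_finite_subgradient:
  fixes f :: "'a::euclidean_space \<Rightarrow> ereal"
  assumes proper: "proper_fun f"
    and "is_arg_min (\<lambda>w. f w - ereal (g \<bullet> w)) (\<lambda>_. True) x"
  shows "\<bar>f x\<bar> \<noteq> \<infinity>" and "g \<in> convex_subdiff f x"
proof -
  have le: "f x - ereal (g \<bullet> x) \<le> f y - ereal (g \<bullet> y)" for y
    using assms(2) by (auto simp: is_arg_min_linorder)
  obtain w where "f w \<noteq> \<infinity>" using proper by (auto simp: proper_fun_def)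
  then show fin: "\<bar>f x\<bar> \<noteq> \<infinity>"
    using le[of w] proper by (cases "f x"; cases "f w") (auto simp: proper_fun_def)
  show "g \<in> convex_subdiff f x"
    unfolding convex_subdiff_def
  proof safe
    fix y
    show "f x + ereal (g \<bullet> (y - x)) \<le> f y"
      using le[of y] fin by (cases "f x"; cases "f y") (auto simp: inner_diff_right)
  qed
qed

theorem lemma5:
  fixes f1 f2 :: "real ^ 'd \<Rightarrow> ereal"
    and \<mu>1 \<mu>2 L2 :: real and L1 :: ereal
    and x0 x1 x2 :: "real ^ 'd"
  assumes "dc_assumption \<mu>1 L1 \<mu>2 (ereal L2) f1 f2"
    and "L2 \<in> {0..\<mu>1}"
    and "\<mu>2 \<in> {- L2 * \<mu>1 / (L2 + \<mu>1)..<L2}"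
    and "\<mu>1 + \<mu>2 > 0"
    and "x0 \<in> dom_subdiff \<mu>1 f1"
    and "dca_step \<mu>2 f1 f2 x0 x1"
    and "dca_step \<mu>2 f1 f2 x1 x2"
  shows "dc_objective f1 f2 x0 - dc_objective f1 f2 x1
           \<ge> ereal (\<mu>1\<^sup>2 * (L2 + \<mu>1) / L2\<^sup>2 * (1 / 2) * (norm (x1 - x2))\<^sup>2)"
proof -
  have proper1: "proper_fun f1" and conv1: "econvex (sub_quad \<mu>1 f1)"
    and proper2: "proper_fun f2" and conv2: "econvex (sub_quad \<mu>2 f2)"
    and fin2: "\<And>x. f2 x \<noteq> \<infinity>"
    and conc2: "convex_on UNIV (\<lambda>x. L2 / 2 * (norm x)\<^sup>2 - real_of_ereal (f2 x))"
    using assms(1) by (auto simp: dc_assumption_def curv_class_def)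
  \<comment> \<open>For \<open>L2 = 0\<close> the interval for \<open>\<mu>2\<close> would be the
    empty \<open>{0..<0}\<close>.\<close>
  have "L2 \<noteq> 0" using assms(3) by auto
  then have pos: "0 < L2" "0 < \<mu>1" and lt: "\<mu>2 < L2" and ge: "- L2 * \<mu>1 / (L2 + \<mu>1) \<le> \<mu>2"
    using assms(2,3) by auto
  define h where "h x = real_of_ereal (f2 x)" for x
  have h: "f2 x = ereal (h x)" for x
    using fin2[of x] proper2 by (cases "f2 x") (auto simp: h_def proper_fun_def)
  obtain g0 where g0: "g0 \<in> subdiff \<mu>2 f2 x0"
    and min0: "is_arg_min (\<lambda>w. f1 w - ereal (g0 \<bullet> w)) (\<lambda>_. True) x1"
    using assms(6) by (auto simp: dca_step_def)
  obtain g1 where g1: "g1 \<in> subdiff \<mu>2 f2 x1"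
    and min1: "is_arg_min (\<lambda>w. f1 w - ereal (g1 \<bullet> w)) (\<lambda>_. True) x2"
    using assms(7) by (auto simp: dca_step_def)
  obtain a1 where a1: "f1 x1 = ereal a1"
    using arg_min_finite_subgradient(1)[OF proper1 min0] by (cases "f1 x1") auto
  obtain a2 where a2: "f1 x2 = ereal a2"
    using arg_min_finite_subgradient(1)[OF proper1 min1] by (cases "f1 x2") auto
  note strong0 = convex_subdiff_strong[OF conv1 proper1 arg_min_finite_subgradient(2)[OF proper1 min0]]
  note strong1 = convex_subdiff_strong[OF conv1 proper1 arg_min_finite_subgradient(2)[OF proper1 min1]]
  \<comment> \<open>The indices shift: \<open>g0\<close> is a subgradient of \<open>f1\<close> at
    \<open>x1\<close> and \<open>g1\<close> one at \<open>x2\<close>. Adding the two inequalities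
    cancels the values of \<open>f1\<close>.\<close>
  have "\<mu>1 * (norm (x2 - x1))\<^sup>2 \<le> (g1 - g0) \<bullet> (x2 - x1)"
    using strong0[of x2] strong1[of x1]
    by (simp add: a1 a2 norm_minus_commute[of x1 x2] inner_simps algebra_simps)
  then have "\<mu>1 * norm (x1 - x2) \<le> norm (g1 - g0)"
    using strong_monotone_norm_le by (metis norm_minus_commute)
  then have "(\<mu>1 * norm (x1 - x2))\<^sup>2 \<le> (norm (g1 - g0))\<^sup>2"
    using pos by (intro power_mono) auto
  then have "(L2 + \<mu>1) / L2\<^sup>2 * (\<mu>1 * norm (x1 - x2))\<^sup>2 \<le> (L2 + \<mu>1) / L2\<^sup>2 * (norm (g1 - g0))\<^sup>2"
    using pos by (intro mult_left_mono) auto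
  moreover
  have low0: "h x0 + g0 \<bullet> (y - x0) + \<mu>2 / 2 * (norm (y - x0))\<^sup>2 \<le> h y" for y
    using subdiff_lower_bound[OF conv2 proper2 g0, of y] by (simp add: h)
  have low1: "h x1 + g1 \<bullet> (y - x1) + \<mu>2 / 2 * (norm (y - x1))\<^sup>2 \<le> h y" for y
    using subdiff_lower_bound[OF conv2 proper2 g1, of y] by (simp add: h)
  note up0 = curvature_upper_bound[OF conc2[folded h_def] low0]
  note up1 = curvature_upper_bound[OF conc2[folded h_def] low1]
  define R where "R = (norm (g1 - g0 - \<mu>2 *\<^sub>R (x1 - x0)))\<^sup>2 / (L2 - \<mu>2)"
  have int01: "h x0 + g0 \<bullet> (x1 - x0) + \<mu>2 / 2 * (norm (x1 - x0))\<^sup>2 + R / 2 \<le> h x1"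
    using interpolation_inequality[OF low0 up1 lt] by (simp add: R_def mult.commute)
  have int10: "h x1 - g1 \<bullet> (x1 - x0) + \<mu>2 / 2 * (norm (x1 - x0))\<^sup>2 + R / 2 \<le> h x0"
  proof -
    have "norm (g0 - g1 - \<mu>2 *\<^sub>R (x0 - x1)) = norm (g1 - g0 - \<mu>2 *\<^sub>R (x1 - x0))"
      by (subst norm_minus_cancel[symmetric]) (simp add: algebra_simps)
    then show ?thesis
      using interpolation_inequality[OF low1 up0 lt]
      by (simp add: R_def mult.commute norm_minus_commute[of x0 x1] inner_diff_right)
  qed
  have "\<mu>2 * (norm (x1 - x0))\<^sup>2 + R \<le> (g1 - g0) \<bullet> (x1 - x0)"
    using int01 int10 by (simp add: inner_diff_left)
  from descent_quadratic_bound[OF pos(1) _ lt ge this[unfolded R_def]]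
  have "(L2 + \<mu>1) / L2\<^sup>2 * (norm (g1 - g0))\<^sup>2 \<le> (\<mu>1 + \<mu>2) * (norm (x1 - x0))\<^sup>2 + R"
    using pos by (simp add: R_def)
  ultimately have key: "\<mu>1\<^sup>2 * (L2 + \<mu>1) / L2\<^sup>2 * (1 / 2) * (norm (x1 - x2))\<^sup>2
      \<le> ((\<mu>1 + \<mu>2) * (norm (x1 - x0))\<^sup>2 + R) / 2"
    by (simp add: power_mult_distrib mult_ac)
  show ?thesis
  proof (cases "f1 x0")
    case (real a0)
    have "a1 - g0 \<bullet> (x1 - x0) + \<mu>1 / 2 * (norm (x1 - x0))\<^sup>2 \<le> a0"
      using strong0[of x0] by (simp add: a1 real norm_minus_commute[of x0 x1] inner_diff_right)
    \<comment> \<open>The terms in \<open>g0\<close> cancel because the same vector is a subgradient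
      of \<open>f2\<close> at \<open>x0\<close> and of \<open>f1\<close> at
      \<open>x1\<close>.\<close>
    then have "((\<mu>1 + \<mu>2) * (norm (x1 - x0))\<^sup>2 + R) / 2 \<le> a0 - h x0 - (a1 - h x1)"
      using int01 by (simp add: distrib_right add_divide_distrib)
    from order_trans[OF key this] show ?thesis
      by (simp only: dc_objective_def h a1 real ereal_minus ereal_less_eq)
  next
    \<comment> \<open>The objective is \<infinity> at \<open>x0\<close> and finite at
      \<open>x1\<close>, so the decrease is \<infinity>.\<close>
    case PInf
    then show ?thesis by (simp add: dc_objective_def h a1)
  next
    case MInf
    then show ?thesis using proper1 by (simp add: proper_fun_def)
  qed
qed

end
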